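(* Let $(E,\|\cdot\|_E)$ and $(F,\|\cdot\|_F)$ be real normed spaces, let $\mu:\mathbb{R}_+\to\mathbb{R}_+$ be a non-decreasing function such that $\mu(t)/2\le \mu(t/2)$ for all $t\in\mathbb{R}_+$, and let $T:E\to F$ be a $\mu$-isometry. Then for all $a,b\in E$ and every integer $n\ge 0$, $$\left\|T\left(\frac{a+b}{2}\right)-\frac{Ta+Tb}{2}\right\|_F\le \mu^{\circ(2^{n+1}-1)}\left(\frac{\|a-b\|_E}{2^{n+1}}\right).$$
   Context: $\mathbb{R}_+=\{x\in\mathbb{R}: x\ge 0\}$. For a non-decreasing function $\mu:\mathbb{R}_+\to\mathbb{R}_+$, a map $T:E\to F$ between metric spaces $(E,d_E)$ and $(F,d_F)$ is called a $\mu$-isometry if $T$ is a bijection, $d_F(Tx,Ty)\le\mu(d_E(x,y))$ for all $x,y\in E$, and $d_E(T^{-1}f,T^{-1}g)\le\mu(d_F(f,g))$ for all $f,g\in F$. Normed spaces carry the metric induced by the norm. No continuity or linearity of $T$ is assumed. For an integer $k\ge 1$, $\mu^{\circ k}=\mu\circ\mu\circ\cdots\circ\mu$ denotes $\mu$ composed with itself $k$ times. *)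

theory Defs
  imports Complex_Main
begin

text \<open>
  The half-line of non-negative reals is the set \<open>{0..}\<close>; a function on it is represented by a
  function of type \<^typ>\<open>real \<Rightarrow> real\<close> whose values at negative arguments are irrelevant.
  Under bijectivity, \<open>inv T\<close> is the genuine two-sided inverse.
\<close>

definition mu_isometry :: "(real \<Rightarrow> real) \<Rightarrow> ('a::metric_space \<Rightarrow> 'b::metric_space) \<Rightarrow> bool"
  where "mu_isometry \<mu> T \<longleftrightarrow>
    bij T \<and>
    (\<forall>x y. dist (T x) (T y) \<le> \<mu> (dist x y)) \<and>
    (\<forall>f g. dist (inv T f) (inv T g) \<le> \<mu> (dist f g))"

end

theory Submission
  imports Defs
begin

text \<open>
  Let \<open>m\<close> and \<open>p\<close> be the midpoints of \<open>a, b\<close> and of \<open>T a, T b\<close>. Conjugating the reflection at \<open>p\<close>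
  by \<open>T\<close> and following it by the reflection at \<open>m\<close> yields a \<open>\<mu> \<circ> \<mu>\<close>-isometry \<open>S\<close> of \<open>E\<close> that
  fixes \<open>a\<close> and \<open>b\<close> and satisfies \<open>2 \<parallel>T m - p\<parallel> \<le> \<mu> (\<parallel>S m - m\<parallel>)\<close>. The bound with index \<open>n\<close>
  for \<open>S\<close> therefore gives the bound with index \<open>n + 1\<close> for \<open>T\<close>, the factor \<open>2\<close> being moved
  inside by \<open>\<mu> t / 2 \<le> \<mu> (t / 2)\<close>.
\<close>

text \<open>These conditions are bundled because the induction replaces \<open>\<mu>\<close> by
  \<open>\<mu> \<circ> \<mu>\<close>: what is assumed of a modulus has to survive
  composition.\<close>

definition halving_modulus :: "(real \<Rightarrow> real) \<Rightarrow> bool"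
  where "halving_modulus \<mu> \<longleftrightarrow>
    \<mu> ` {0..} \<subseteq> {0..} \<and> mono_on {0..} \<mu> \<and> (\<forall>t\<ge>0. \<mu> t / 2 \<le> \<mu> (t / 2))"

lemma halving_modulus_nonneg: "halving_modulus \<mu> \<Longrightarrow> 0 \<le> t \<Longrightarrow> 0 \<le> \<mu> t"
  unfolding halving_modulus_def by auto

lemma halving_modulus_mono: "halving_modulus \<mu> \<Longrightarrow> 0 \<le> s \<Longrightarrow> s \<le> t \<Longrightarrow> \<mu> s \<le> \<mu> t"
  unfolding halving_modulus_def by (auto intro: mono_onD)

lemma halving_modulus_half: "halving_modulus \<mu> \<Longrightarrow> 0 \<le> t \<Longrightarrow> \<mu> t / 2 \<le> \<mu> (t / 2)"
  unfolding halving_modulus_def by auto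

lemma halving_modulus_id: "halving_modulus id"
  by (auto simp: halving_modulus_def mono_on_def)

lemma halving_modulus_comp:
  assumes \<mu>: "halving_modulus \<mu>" and \<nu>: "halving_modulus \<nu>"
  shows "halving_modulus (\<mu> \<circ> \<nu>)"
proof -
  have "\<mu> (\<nu> t) / 2 \<le> \<mu> (\<nu> (t / 2))" if "0 \<le> t" for t
  proof -
    have nonneg: "0 \<le> \<nu> t"
      by (rule halving_modulus_nonneg[OF \<nu> that])
    have "\<mu> (\<nu> t) / 2 \<le> \<mu> (\<nu> t / 2)"
      by (rule halving_modulus_half[OF \<mu> nonneg])
    also have "\<dots> \<le> \<mu> (\<nu> (t / 2))"
      using nonneg by (intro halving_modulus_mono[OF \<mu>] halving_modulus_half[OF \<nu> that]) simp
    finally show ?thesis .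
  qed
  moreover have "0 \<le> \<mu> (\<nu> t)" if "0 \<le> t" for t
    by (rule halving_modulus_nonneg[OF \<mu> halving_modulus_nonneg[OF \<nu> that]])
  moreover have "\<mu> (\<nu> s) \<le> \<mu> (\<nu> t)" if "0 \<le> s" "s \<le> t" for s t
    by (rule halving_modulus_mono[OF \<mu> halving_modulus_nonneg[OF \<nu> that(1)]
          halving_modulus_mono[OF \<nu> that]])
  ultimately show ?thesis
    unfolding halving_modulus_def by (auto intro!: mono_onI)
qed

lemma halving_modulus_funpow: "halving_modulus \<mu> \<Longrightarrow> halving_modulus (\<mu> ^^ k)"
  by (induction k) (auto intro: halving_modulus_id halving_modulus_comp)

lemma mu_isometry_inv: "mu_isometry \<mu> T \<Longrightarrow> mu_isometry \<mu> (inv T)"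
  unfolding mu_isometry_def by (auto simp: bij_imp_bij_inv inv_inv_eq)

text \<open>The inverse composes in the opposite order and so obeys
  \<open>\<nu> \<circ> \<mu>\<close>; commutation lets one modulus serve both directions.\<close>

lemma mu_isometry_comp:
  assumes S: "mu_isometry \<mu> S" and T: "mu_isometry \<nu> T"
    and "halving_modulus \<mu>" "halving_modulus \<nu>" "\<mu> \<circ> \<nu> = \<nu> \<circ> \<mu>"
  shows "mu_isometry (\<mu> \<circ> \<nu>) (S \<circ> T)"
proof -
  have S': "bij S" "dist (S x) (S y) \<le> \<mu> (dist x y)" "dist (inv S f) (inv S g) \<le> \<mu> (dist f g)"
    for x y f g using S by (auto simp: mu_isometry_def)
  have T': "bij T" "dist (T x) (T y) \<le> \<nu> (dist x y)" "dist (inv T f) (inv T g) \<le> \<nu> (dist f g)"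
    for x y f g using T by (auto simp: mu_isometry_def)
  have "dist (S (T x)) (S (T y)) \<le> \<mu> (\<nu> (dist x y))" for x y
    by (rule order_trans[OF S'(2) halving_modulus_mono[OF assms(3) zero_le_dist T'(2)]])
  moreover have "dist (inv T (inv S f)) (inv T (inv S g)) \<le> \<nu> (\<mu> (dist f g))" for f g
    by (rule order_trans[OF T'(3) halving_modulus_mono[OF assms(4) zero_le_dist S'(3)]])
  moreover have "\<nu> (\<mu> t) = \<mu> (\<nu> t)" for t
    using fun_cong[OF assms(5), of t] by simp
  ultimately show ?thesis
    using S'(1) T'(1) by (simp add: mu_isometry_def o_inv_distrib bij_comp)
qed

text \<open>This map is the point reflection at \<open>c /\<^sub>R 2\<close>, an isometric
  involution.\<close>

lemma mu_isometry_reflection: "mu_isometry id (\<lambda>x::'a::real_normed_vector. c - x)"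
proof -
  have "inv (\<lambda>x. c - x) = (\<lambda>x. c - x)"
    by (rule inv_equality) auto
  moreover have "bij (\<lambda>x. c - x)"
    by (rule involuntory_imp_bij) simp
  ultimately show ?thesis
    by (simp add: mu_isometry_def dist_norm norm_minus_commute)
qed

definition midpoint_defect :: "('e::real_normed_vector \<Rightarrow> 'f::real_normed_vector) \<Rightarrow> 'e \<Rightarrow> 'e \<Rightarrow> real"
  where "midpoint_defect T a b = norm (T ((a + b) /\<^sub>R 2) - (T a + T b) /\<^sub>R 2)"

text \<open>The midpoint lies at distance \<open>norm (a - b) / 2\<close> from both \<open>a\<close>
  and \<open>b\<close>, and the defect vector is the average of the two image differences. This is
  the case \<open>n = 0\<close>.\<close>

lemma midpoint_defect_le:
  fixes T :: "'e::real_normed_vector \<Rightarrow> 'f::real_normed_vector"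
  assumes "mu_isometry \<mu> T"
  shows "midpoint_defect T a b \<le> \<mu> (norm (a - b) / 2)"
proof -
  let ?m = "(a + b) /\<^sub>R 2"
  have "?m - a = (b - a) /\<^sub>R 2" "?m - b = (a - b) /\<^sub>R 2"
    by (simp_all add: algebra_simps flip: scaleR_2)
  then have "dist ?m a = norm (a - b) / 2" "dist ?m b = norm (a - b) / 2"
    by (simp_all add: dist_norm norm_minus_commute)
  then have bounds: "norm (T ?m - T a) \<le> \<mu> (norm (a - b) / 2)" "norm (T ?m - T b) \<le> \<mu> (norm (a - b) / 2)"
    using assms unfolding mu_isometry_def dist_norm by metis+
  have "T ?m - (T a + T b) /\<^sub>R 2 = ((T ?m - T a) + (T ?m - T b)) /\<^sub>R 2"
    by (simp add: algebra_simps flip: scaleR_2)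
  then have "midpoint_defect T a b \<le> (norm (T ?m - T a) + norm (T ?m - T b)) / 2"
    using norm_triangle_ineq[of "T ?m - T a" "T ?m - T b"] by (simp add: midpoint_defect_def)
  also have "\<dots> \<le> (\<mu> (norm (a - b) / 2) + \<mu> (norm (a - b) / 2)) / 2"
    using bounds by (intro divide_right_mono add_mono) auto
  finally show ?thesis by simp
qed

lemma midpoint_defect_reflection:
  fixes T :: "'e::real_normed_vector \<Rightarrow> 'f::real_normed_vector"
  assumes \<mu>: "halving_modulus \<mu>" and T: "mu_isometry \<mu> T"
  obtains S :: "'e \<Rightarrow> 'e" where "mu_isometry (\<mu> \<circ> \<mu>) S"
    and "2 * midpoint_defect T a b \<le> \<mu> (midpoint_defect S a b)"
proof
  \<comment> \<open>The inner reflection swaps \<open>T a\<close> and \<open>T b\<close>, the outer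
    one swaps \<open>a\<close> and \<open>b\<close>; hence \<open>S\<close> fixes both
    points.\<close>
  define S where "S = (\<lambda>x. (a + b) - x) \<circ> (inv T \<circ> ((\<lambda>y. (T a + T b) - y) \<circ> T))"
  \<comment> \<open>The modulus is bracketed like \<open>S\<close>: each reflection contributes
    \<open>id\<close>, while \<open>T\<close> and \<open>inv T\<close> contribute
    \<open>\<mu>\<close> each.\<close>
  have "mu_isometry (id \<circ> (\<mu> \<circ> (id \<circ> \<mu>))) S"
    unfolding S_def using \<mu> T
    by (intro mu_isometry_comp mu_isometry_reflection mu_isometry_inv halving_modulus_id
        halving_modulus_comp) auto
  then show "mu_isometry (\<mu> \<circ> \<mu>) S" by simp
  have "bij T" using T by (simp add: mu_isometry_def)
  then have inv: "inv T (T x) = x" "T (inv T y) = y" for x y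
    by (simp_all add: bij_is_inj bij_is_surj surj_f_inv_f)
  let ?m = "(a + b) /\<^sub>R 2"
  let ?w = "inv T (T a + T b - T ?m)"
  have "S a = a" "S b = b" by (simp_all add: S_def inv)
  moreover have "S ?m - ?m = ?m - ?w"
    by (simp add: S_def algebra_simps flip: scaleR_2)
  ultimately have defect: "midpoint_defect S a b = dist ?m ?w"
    by (simp add: midpoint_defect_def dist_norm)
  \<comment> \<open>\<open>T ?w\<close> is the reflection of \<open>T ?m\<close> at the midpoint of
    \<open>T a\<close> and \<open>T b\<close>, whence the factor 2.\<close>
  have "T ?m - T ?w = 2 *\<^sub>R (T ?m - (T a + T b) /\<^sub>R 2)"
    by (simp add: inv algebra_simps scaleR_2)
  then have "2 * midpoint_defect T a b = dist (T ?m) (T ?w)"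
    by (simp add: midpoint_defect_def dist_norm)
  also have "\<dots> \<le> \<mu> (dist ?m ?w)"
    using T by (simp add: mu_isometry_def)
  finally show "2 * midpoint_defect T a b \<le> \<mu> (midpoint_defect S a b)"
    by (simp add: defect)
qed

text \<open>The bound for self-maps of the domain is a hypothesis, so that the step serves both
  inside the induction on self-maps and once more for \<open>T\<close> into another space.\<close>

lemma midpoint_defect_step:
  fixes T :: "'e::real_normed_vector \<Rightarrow> 'f::real_normed_vector"
  assumes \<mu>: "halving_modulus \<mu>" and T: "mu_isometry \<mu> T"
    and bound: "\<And>S::'e \<Rightarrow> 'e. mu_isometry (\<mu> \<circ> \<mu>) S \<Longrightarrow>
      midpoint_defect S a b \<le> ((\<mu> \<circ> \<mu>) ^^ (2 ^ (n + 1) - 1)) (norm (a - b) / 2 ^ (n + 1))"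
  shows "midpoint_defect T a b \<le> (\<mu> ^^ (2 ^ (Suc n + 1) - 1)) (norm (a - b) / 2 ^ (Suc n + 1))"
proof -
  define k :: nat where "k = 2 ^ (n + 1) - 1"
  define r where "r = norm (a - b) / 2 ^ (n + 1)"
  \<comment> \<open>This keeps the natural subtraction in \<open>k\<close> from truncating. In the
    exponent, \<open>2 * k\<close> counts the \<open>k\<close> iterates of
    \<open>\<mu> \<circ> \<mu>\<close>, and the extra one is the \<open>\<mu>\<close> from the
    reflection estimate.\<close>
  have "(1::nat) \<le> 2 ^ (n + 1)" by (rule one_le_power) simp
  then have exponent: "2 ^ (Suc n + 1) - 1 = Suc (2 * k)"
    unfolding k_def add_Suc power_Suc by linarith
  obtain S :: "'e \<Rightarrow> 'e" where S: "mu_isometry (\<mu> \<circ> \<mu>) S"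
    and le: "2 * midpoint_defect T a b \<le> \<mu> (midpoint_defect S a b)"
    using midpoint_defect_reflection[OF \<mu> T] by blast
  have "(\<mu> \<circ> \<mu>) ^^ k = \<mu> ^^ (2 * k)"
    unfolding funpow_mult[symmetric] by (simp add: numeral_2_eq_2)
  then have "midpoint_defect S a b \<le> (\<mu> ^^ (2 * k)) r"
    using bound[OF S] by (simp only: k_def r_def)
  moreover have "0 \<le> midpoint_defect S a b"
    by (simp add: midpoint_defect_def)
  ultimately have "\<mu> (midpoint_defect S a b) \<le> \<mu> ((\<mu> ^^ (2 * k)) r)"
    by (intro halving_modulus_mono[OF \<mu>])
  then have "2 * midpoint_defect T a b \<le> (\<mu> ^^ Suc (2 * k)) r"
    using le by simp
  then have "midpoint_defect T a b \<le> (\<mu> ^^ Suc (2 * k)) r / 2"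
    by simp
  \<comment> \<open>The whole iterate is again a halving modulus, so the factor passes through it at
    once.\<close>
  also have "\<dots> \<le> (\<mu> ^^ Suc (2 * k)) (r / 2)"
    by (rule halving_modulus_half[OF halving_modulus_funpow[OF \<mu>]]) (simp add: r_def)
  also have "r / 2 = norm (a - b) / 2 ^ (Suc n + 1)"
    by (simp add: r_def)
  finally show ?thesis
    unfolding exponent .
qed

text \<open>An induction hypothesis has fixed types, and \<open>S\<close> maps the domain to itself;
  the induction therefore runs over self-maps, with \<open>\<mu>\<close> and \<open>T\<close>
  arbitrary since \<open>S\<close> has modulus \<open>\<mu> \<circ> \<mu>\<close>.\<close>

lemma midpoint_defect_endo:
  fixes T :: "'e::real_normed_vector \<Rightarrow> 'e"
  assumes "halving_modulus \<mu>" "mu_isometry \<mu> T"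
  shows "midpoint_defect T a b \<le> (\<mu> ^^ (2 ^ (n + 1) - 1)) (norm (a - b) / 2 ^ (n + 1))"
  using assms
proof (induction n arbitrary: \<mu> T)
  case 0
  then show ?case using midpoint_defect_le by simp
next
  case (Suc n)
  show ?case
    by (rule midpoint_defect_step[OF Suc.prems
          Suc.IH[OF halving_modulus_comp[OF Suc.prems(1) Suc.prems(1)]]])
qed

theorem theorem2p1:
  fixes \<mu> :: "real \<Rightarrow> real"
    and T :: "'e::real_normed_vector \<Rightarrow> 'f::real_normed_vector"
    and a b :: 'e
    and n :: nat
  assumes mu_nonneg: "\<mu> ` {0..} \<subseteq> {0..}"
    and mu_mono: "mono_on {0..} \<mu>"
    and mu_half: "\<And>t. t \<ge> 0 \<Longrightarrow> \<mu> t / 2 \<le> \<mu> (t / 2)"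
    and T: "mu_isometry \<mu> T"
  shows "norm (T ((a + b) /\<^sub>R 2) - (T a + T b) /\<^sub>R 2)
           \<le> (\<mu> ^^ (2 ^ (n + 1) - 1)) (norm (a - b) / 2 ^ (n + 1))"
proof -
  have \<mu>: "halving_modulus \<mu>"
    using mu_nonneg mu_mono mu_half by (simp add: halving_modulus_def)
  have "midpoint_defect T a b \<le> (\<mu> ^^ (2 ^ (n + 1) - 1)) (norm (a - b) / 2 ^ (n + 1))"
  \<comment> \<open>For positive \<open>n\<close>, a single reflection step leads from
    \<open>T\<close> to self-maps of the domain, where the induction is already done.\<close>
  proof (cases n)
    case 0
    then show ?thesis using midpoint_defect_le[OF T] by simp
  next
    case (Suc k)
    show ?thesis
      unfolding Suc
      by (rule midpoint_defect_step[OF \<mu> T midpoint_defect_endo[OF halving_modulus_comp[OF \<mu> \<mu>]]])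
  qed
  then show ?thesis
    by (simp add: midpoint_defect_def)
qed

end
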